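(* Let $\mu,\nu\in\mathcal{P}_2(\mathbb{R}^n)$ have common barycentre. Suppose that $\mathcal{I}(\mu,\nu)$ is attained by a function $u\in\mathcal{C}^{1,1}(\mathbb{R}^n)$ with isometric derivative which, after modifying by an affine function, can be taken to be of the form $u=u_{V_1,V_2}$, where $V_1,V_2$ are orthogonal, mutually complementing subspaces of $\mathbb{R}^n$. Suppose that $\pi\in\Gamma_{bm}(\mu,\nu,V_1,V_2)$. Let $\sigma\in\mathcal{P}((\mathbb{R}^n)^3)$ be the pushforward of $\pi$ via the map $R\colon\mathbb{R}^n\times\mathbb{R}^n\to\mathbb{R}^n\times\mathbb{R}^n\times\mathbb{R}^n$ defined by $$R(x,y)=(x,y,P_{V_2}x+P_{V_1}y)\quad\text{for }x,y\in\mathbb{R}^n.$$ Then $\sigma\in\Sigma(\mu,\nu)$ and $\sigma$ is optimal for $\mathcal{J}(\mu,\nu)$.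
   Context: $\|\cdot\|$ is the Euclidean norm and $P_W$ the orthogonal projection onto $W$. $\mathcal{P}_p(\mathbb{R}^n)$ is the set of Borel probability measures on $\mathbb{R}^n$ with finite $p$-th moment; the barycentre of $\mu$ is $\int x\,d\mu(x)$; $\mathrm{P}_i$ denotes the $i$-th marginal; $\Gamma(\mu,\nu)$ is the set of Borel probability measures on $\mathbb{R}^n\times\mathbb{R}^n$ with marginals $\mu,\nu$. $\mathcal{C}^{1,1}(\mathbb{R}^n)$ is the set of differentiable real functions with Lipschitz derivative. $V_1,V_2$ mutually complementing means $V_1\oplus V_2=\mathbb{R}^n$. $u_{V_1,V_2}(v)=\frac12\|P_{V_1}v\|^2-\frac12\|P_{V_2}v\|^2$. $\mathcal{I}(\mu,\nu)=\sup\{\int v\,d(\nu-\mu)\mid v\in\mathcal{C}^{1,1}(\mathbb{R}^n)\text{ has }1\text{-Lipschitz derivative}\}$. $\Sigma(\mu,\nu)$ is the set of Borel probability measures $\sigma$ on $(\mathbb{R}^n)^3$ with $\mathrm{P}_1\sigma=\mu$, $\mathrm{P}_2\sigma=\nu$, $\mathrm{P}_3\sigma\in\mathcal{P}_1(\mathbb{R}^n)$ and $\int(z-x)g(x)\,d\sigma(x,y,z)=\int(z-y)h(y)\,d\sigma(x,y,z)=0$ for all bounded Borel $g,h\colon\mathbb{R}^n\to\mathbb{R}$. $\mathcal{J}(\mu,\nu)=\inf\{\int\frac12(\|x-z\|^2+\|y-z\|^2)\,d\sigma(x,y,z)\mid\sigma\in\Sigma(\mu,\nu)\}$; optimal means attaining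 the infimum. $\Gamma_{bm}(\mu,\nu,V_1,V_2)$ is the set of $\pi\in\Gamma(\mu,\nu)$ such that for all bounded Borel $g,h\colon\mathbb{R}^n\to\mathbb{R}$: $\int P_{V_1}(y)g(x)\,d\pi(x,y)=\int P_{V_1}(x)g(x)\,d\pi(x,y)$ and $\int P_{V_2}(x)h(y)\,d\pi(x,y)=\int P_{V_2}(y)h(y)\,d\pi(x,y)$. *)

theory Defs
  imports "HOL-Probability.Probability"
begin

definition orth_proj :: "'a::euclidean_space set \<Rightarrow> 'a \<Rightarrow> 'a" where
  "orth_proj W x = (THE y. y \<in> W \<and> (\<forall>w\<in>W. orthogonal (x - y) w))"

definition complementing :: "'a::euclidean_space set \<Rightarrow> 'a set \<Rightarrow> bool" where
  "complementing V1 V2 \<longleftrightarrow> V1 + V2 = UNIV \<and> V1 \<inter> V2 = {0}"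

definition borel_prob :: "'a::topological_space measure \<Rightarrow> bool" where
  "borel_prob \<mu> \<longleftrightarrow> prob_space \<mu> \<and> sets \<mu> = sets borel"

definition prob_moment :: "real \<Rightarrow> 'a::euclidean_space measure set" where
  "prob_moment p = {\<mu>. borel_prob \<mu> \<and> integrable \<mu> (\<lambda>x. norm x powr p)}"

definition barycentre :: "'a::euclidean_space measure \<Rightarrow> 'a" where
  "barycentre \<mu> = (LINT x|\<mu>. x)"

definition bounded_borel :: "('a::topological_space \<Rightarrow> real) set" where
  "bounded_borel = {g \<in> borel_measurable borel. bounded (range g)}"

text \<open>
  The derivative as a map into the dual space with the operator norm. It is meaningful only
  for functions that are differentiable everywhere.
\<close>

definition derivative_map :: "('a::euclidean_space \<Rightarrow> real) \<Rightarrow> 'a \<Rightarrow> ('a \<Rightarrow>\<^sub>L real)" where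
  "derivative_map v x = Blinfun (frechet_derivative v (at x))"

definition C11 :: "('a::euclidean_space \<Rightarrow> real) set" where
  "C11 = {v. (\<forall>x. v differentiable (at x)) \<and> (\<exists>L. L-lipschitz_on UNIV (derivative_map v))}"

definition isometric_derivative :: "('a::euclidean_space \<Rightarrow> real) \<Rightarrow> bool" where
  "isometric_derivative v \<longleftrightarrow>
    (\<forall>x y. dist (derivative_map v x) (derivative_map v y) = dist x y)"

definition u_fun :: "'a::euclidean_space set \<Rightarrow> 'a set \<Rightarrow> 'a \<Rightarrow> real" where
  "u_fun V1 V2 v = 1/2 * (norm (orth_proj V1 v))\<^sup>2 - 1/2 * (norm (orth_proj V2 v))\<^sup>2"

text \<open>
  The integral against the signed measure \<open>\<nu> - \<mu>\<close> is the difference of the two integrals. It is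
  the intended one for \<open>\<mu>\<close> and \<open>\<nu>\<close> with finite second moment, since functions in \<open>C11\<close> grow
  at most quadratically. The supremum is extended-real because it may be infinite
  (for example if the barycentres differ).
\<close>

definition I_admissible :: "('a::euclidean_space \<Rightarrow> real) set" where
  "I_admissible = {v \<in> C11. 1-lipschitz_on UNIV (derivative_map v)}"

definition I_functional :: "'a::euclidean_space measure \<Rightarrow> 'a measure \<Rightarrow> ('a \<Rightarrow> real) \<Rightarrow> real" where
  "I_functional \<mu> \<nu> v = (LINT x|\<nu>. v x) - (LINT x|\<mu>. v x)"

definition I_value :: "'a::euclidean_space measure \<Rightarrow> 'a measure \<Rightarrow> ereal" where
  "I_value \<mu> \<nu> = (SUP v\<in>I_admissible. ereal (I_functional \<mu> \<nu> v))"

definition I_attained_by ::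
    "'a::euclidean_space measure \<Rightarrow> 'a measure \<Rightarrow> ('a \<Rightarrow> real) \<Rightarrow> bool" where
  "I_attained_by \<mu> \<nu> u \<longleftrightarrow> u \<in> I_admissible \<and> ereal (I_functional \<mu> \<nu> u) = I_value \<mu> \<nu>"

definition couplings ::
    "'a::euclidean_space measure \<Rightarrow> 'a measure \<Rightarrow> ('a \<times> 'a) measure set" where
  "couplings \<mu> \<nu> = {\<pi>. borel_prob \<pi> \<and> distr \<pi> borel fst = \<mu> \<and> distr \<pi> borel snd = \<nu>}"

text \<open>
  Bochner integrals of non-integrable functions are \<open>0\<close>. This does not affect the two
  definitions below for \<open>\<mu>\<close> and \<open>\<nu>\<close> with finite first moment, where all the integrands
  are integrable.
\<close>

definition Sigma_set ::
    "'a::euclidean_space measure \<Rightarrow> 'a measure \<Rightarrow> ('a \<times> 'a \<times> 'a) measure set" where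
  "Sigma_set \<mu> \<nu> = {\<sigma>. borel_prob \<sigma> \<and>
     distr \<sigma> borel (\<lambda>(x, y, z). x) = \<mu> \<and>
     distr \<sigma> borel (\<lambda>(x, y, z). y) = \<nu> \<and>
     distr \<sigma> borel (\<lambda>(x, y, z). z) \<in> prob_moment 1 \<and>
     (\<forall>g\<in>bounded_borel. (LINT (x, y, z)|\<sigma>. g x *\<^sub>R (z - x)) = 0) \<and>
     (\<forall>h\<in>bounded_borel. (LINT (x, y, z)|\<sigma>. h y *\<^sub>R (z - y)) = 0)}"

definition Gamma_bm ::
    "'a::euclidean_space measure \<Rightarrow> 'a measure \<Rightarrow> 'a set \<Rightarrow> 'a set \<Rightarrow> ('a \<times> 'a) measure set" where
  "Gamma_bm \<mu> \<nu> V1 V2 = {\<pi> \<in> couplings \<mu> \<nu>.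
     (\<forall>g\<in>bounded_borel.
        (LINT (x, y)|\<pi>. g x *\<^sub>R orth_proj V1 y) = (LINT (x, y)|\<pi>. g x *\<^sub>R orth_proj V1 x)) \<and>
     (\<forall>h\<in>bounded_borel.
        (LINT (x, y)|\<pi>. h y *\<^sub>R orth_proj V2 x) = (LINT (x, y)|\<pi>. h y *\<^sub>R orth_proj V2 y))}"

text \<open>
  The cost is a nonnegative Lebesgue integral, so that it is infinite (and not \<open>0\<close>) where the
  integrand is not integrable; the third marginal is only required to have a first moment.
\<close>

definition J_cost :: "('a::euclidean_space \<times> 'a \<times> 'a) measure \<Rightarrow> ennreal" where
  "J_cost \<sigma> = (\<integral>\<^sup>+ (x, y, z). ennreal (1/2 * ((norm (x - z))\<^sup>2 + (norm (y - z))\<^sup>2)) \<partial>\<sigma>)"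

definition J_value :: "'a::euclidean_space measure \<Rightarrow> 'a measure \<Rightarrow> ennreal" where
  "J_value \<mu> \<nu> = (INF \<sigma>\<in>Sigma_set \<mu> \<nu>. J_cost \<sigma>)"

definition J_optimal ::
    "'a::euclidean_space measure \<Rightarrow> 'a measure \<Rightarrow> ('a \<times> 'a \<times> 'a) measure \<Rightarrow> bool" where
  "J_optimal \<mu> \<nu> \<sigma> \<longleftrightarrow> \<sigma> \<in> Sigma_set \<mu> \<nu> \<and> J_cost \<sigma> = J_value \<mu> \<nu>"

definition R_map :: "'a::euclidean_space set \<Rightarrow> 'a set \<Rightarrow> 'a \<times> 'a \<Rightarrow> 'a \<times> 'a \<times> 'a" where
  "R_map V1 V2 = (\<lambda>(x, y). (x, y, orth_proj V2 x + orth_proj V1 y))"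

end

theory Submission
  imports Defs
begin

text \<open>
  Let \<open>P\<^sub>1\<close>, \<open>P\<^sub>2\<close> be the projections onto \<open>V1\<close>, \<open>V2\<close>, let \<open>u = u_fun V1 V2\<close> and let
  \<open>Q = P\<^sub>1 - P\<^sub>2\<close> be the gradient of \<open>u\<close>. For all \<open>x\<close>, \<open>y\<close>, \<open>z\<close> the cost satisfies
  the identity
  \<open>1/2 (\<parallel>x - z\<parallel>\<^sup>2 + \<parallel>y - z\<parallel>\<^sup>2) = u y - u x - Q x \<bullet> (z - x) + Q y \<bullet> (z - y) + gap\<close>,
  where \<open>gap = \<parallel>P\<^sub>1 (y - z)\<parallel>\<^sup>2 + \<parallel>P\<^sub>2 (x - z)\<parallel>\<^sup>2\<close>
  (lemma \<open>cost_identity\<close>).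

  Let \<open>\<tau> \<in> Sigma_set \<mu> \<nu>\<close> have finite cost. Then \<open>z\<close> is square integrable under \<open>\<tau>\<close>, the two
  martingale conditions extend by truncation from bounded test functions to square integrable
  ones (lemma \<open>integral_inner_eq_0_of_bounded_tests\<close>), and so the two gradient terms integrate
  to zero. Hence the cost of \<open>\<tau>\<close> is \<open>I_functional \<mu> \<nu> u\<close> plus the integral of the nonnegative
  gap (lemma \<open>J_cost_eq\<close>). In particular the cost is at least \<open>I_functional \<mu> \<nu> u\<close>,
  with equality if the gap vanishes \<open>\<tau>\<close>-almost everywhere.

  The gap vanishes exactly for \<open>z = P\<^sub>2 x + P\<^sub>1 y\<close>, which holds almost everywhere for the
  pushforward of \<open>\<pi>\<close> under \<open>R_map V1 V2\<close>. That this pushforward belongs to \<open>Sigma_set \<mu> \<nu>\<close> is a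
  restatement of the two conditions in \<open>Gamma_bm\<close>, because
  \<open>z - x = P\<^sub>1 y - P\<^sub>1 x\<close> and \<open>z - y = P\<^sub>2 x - P\<^sub>2 y\<close>. The argument thus needs
  no duality theorem: the quadratic \<open>u\<close> is itself a certificate of optimality.
\<close>

section \<open>Orthogonal projections\<close>

lemma orth_proj_eqI:
  assumes "subspace W" "y \<in> W" "\<And>w. w \<in> W \<Longrightarrow> orthogonal (x - y) w"
  shows "orth_proj W x = y"
  unfolding orth_proj_def
proof (rule the_equality)
  show "y \<in> W \<and> (\<forall>w\<in>W. orthogonal (x - y) w)"
    using assms by auto
next
  fix y'
  assume y': "y' \<in> W \<and> (\<forall>w\<in>W. orthogonal (x - y') w)"
  have "y' - y \<in> W"
    using assms y' by (simp add: subspace_diff)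
  then have "(x - y) \<bullet> (y' - y) = 0" "(x - y') \<bullet> (y' - y) = 0"
    using assms(3) y' by (auto simp: orthogonal_def)
  then have "(y' - y) \<bullet> (y' - y) = 0"
    by (simp add: inner_diff_left)
  then show "y' = y" by simp
qed

lemma orth_proj_in_and_orthogonal:
  assumes "subspace W"
  shows orth_proj_in: "orth_proj W x \<in> W"
    and orth_proj_orthogonal: "w \<in> W \<Longrightarrow> (x - orth_proj W x) \<bullet> w = 0"
proof -
  have sp: "span W = W" using assms by (simp add: span_eq_iff)
  obtain y z where yz: "y \<in> span W" "\<And>w. w \<in> span W \<Longrightarrow> orthogonal z w" "x = y + z"
    using orthogonal_subspace_decomp_exists[of W x] by blast
  then have "orth_proj W x = y"
    using sp by (intro orth_proj_eqI[OF assms]) auto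
  then show "orth_proj W x \<in> W" "w \<in> W \<Longrightarrow> (x - orth_proj W x) \<bullet> w = 0"
    using yz sp by (auto simp: orthogonal_def)
qed

lemma linear_orth_proj:
  assumes "subspace W"
  shows "linear (orth_proj W)"
proof (rule linearI)
  note in_W = orth_proj_in[OF assms] and orth = orth_proj_orthogonal[OF assms]
  show "orth_proj W (x + y) = orth_proj W x + orth_proj W y" for x y
  proof (rule orth_proj_eqI[OF assms])
    show "orthogonal (x + y - (orth_proj W x + orth_proj W y)) w" if "w \<in> W" for w
      using orth[OF that, of x] orth[OF that, of y]
      by (simp add: orthogonal_def algebra_simps)
  qed (simp add: assms subspace_add in_W)
  show "orth_proj W (r *\<^sub>R x) = r *\<^sub>R orth_proj W x" for r x
  proof (rule orth_proj_eqI[OF assms])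
    show "orthogonal (r *\<^sub>R x - r *\<^sub>R orth_proj W x) w" if "w \<in> W" for w
      using orth[OF that, of x]
      by (simp add: orthogonal_def flip: scaleR_diff_right)
  qed (simp add: assms subspace_scale in_W)
qed

lemma borel_measurable_orth_proj:
  assumes "subspace W"
  shows "orth_proj W \<in> borel_measurable borel"
  using linear_orth_proj[OF assms]
  by (intro borel_measurable_continuous_onI linear_continuous_on linear_conv_bounded_linear[THEN iffD1])

lemma norm_orth_proj_le:
  assumes "subspace W"
  shows "norm (orth_proj W x) \<le> norm x"
proof -
  have "(norm x)\<^sup>2 = (norm (orth_proj W x))\<^sup>2 + (norm (x - orth_proj W x))\<^sup>2"
    using orth_proj_orthogonal[OF assms orth_proj_in[OF assms], of x x]
    by (simp add: power2_norm_eq_inner algebra_simps inner_commute)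
  then show ?thesis
    by (metis le_add_same_cancel1 norm_ge_zero power2_le_imp_le zero_le_power2)
qed

lemma orth_proj_complementing:
  assumes "subspace V1" "subspace V2" "\<forall>x\<in>V1. \<forall>y\<in>V2. orthogonal x y" "complementing V1 V2"
  shows "orth_proj V1 x + orth_proj V2 x = x"
proof -
  obtain a b where ab: "a \<in> V1" "b \<in> V2" "x = a + b"
    using assms(4) unfolding complementing_def by (metis UNIV_I set_plus_elim)
  have "orth_proj V1 x = a"
    by (rule orth_proj_eqI[OF assms(1) ab(1)])
      (use assms(3) ab in \<open>simp add: orthogonal_commute[of b]\<close>)
  moreover have "orth_proj V2 x = b"
    by (rule orth_proj_eqI[OF assms(2) ab(2)]) (use assms(3) ab in simp)
  ultimately show ?thesis using ab by simp
qed

section \<open>The cost identity\<close>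

text \<open>
  The summand \<open>\<parallel>P\<^sub>1 (y - z)\<parallel>\<^sup>2 + \<parallel>P\<^sub>2 (x - z)\<parallel>\<^sup>2\<close>, by which the cost exceeds the increment of \<open>u\<close>
  once the gradient terms have been removed.
\<close>
definition cost_gap :: "'a::euclidean_space set \<Rightarrow> 'a set \<Rightarrow> 'a \<times> 'a \<times> 'a \<Rightarrow> real" where
  "cost_gap V1 V2 = (\<lambda>(x, y, z).
     (norm (orth_proj V1 (y - z)))\<^sup>2 + (norm (orth_proj V2 (x - z)))\<^sup>2)"

text \<open>The gradient of \<open>u_fun V1 V2\<close>.\<close>
definition grad_u :: "'a::euclidean_space set \<Rightarrow> 'a set \<Rightarrow> 'a \<Rightarrow> 'a" where
  "grad_u V1 V2 x = orth_proj V1 x - orth_proj V2 x"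

context
  fixes V1 V2 :: "'a::euclidean_space set"
  assumes subspaces: "subspace V1" "subspace V2"
    and orth: "\<forall>x\<in>V1. \<forall>y\<in>V2. orthogonal x y"
    and compl: "complementing V1 V2"
begin

lemma inner_decompose:
  "x \<bullet> y = orth_proj V1 x \<bullet> orth_proj V1 y + orth_proj V2 x \<bullet> orth_proj V2 y"
proof -
  have "orth_proj V1 v \<bullet> orth_proj V2 w = 0" for v w
    using orth subspaces by (auto simp: orthogonal_def orth_proj_in)
  moreover have "x \<bullet> y = (orth_proj V1 x + orth_proj V2 x) \<bullet> (orth_proj V1 y + orth_proj V2 y)"
    by (simp add: orth_proj_complementing[OF subspaces orth compl])
  ultimately show ?thesis
    by (simp add: algebra_simps inner_commute)
qed

lemma orth_proj_orth_proj:
  "orth_proj V1 (orth_proj V1 x) = orth_proj V1 x"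
  "orth_proj V2 (orth_proj V2 x) = orth_proj V2 x"
  "orth_proj V1 (orth_proj V2 x) = 0"
  "orth_proj V2 (orth_proj V1 x) = 0"
proof -
  have "orthogonal v w" "orthogonal w v" if "v \<in> V1" "w \<in> V2" for v w
    using that orth by (auto simp: orthogonal_commute)
  then show "orth_proj V1 (orth_proj V1 x) = orth_proj V1 x"
      "orth_proj V2 (orth_proj V2 x) = orth_proj V2 x"
      "orth_proj V1 (orth_proj V2 x) = 0" "orth_proj V2 (orth_proj V1 x) = 0"
    using subspaces by (simp_all add: orth_proj_eqI orth_proj_in subspace_0 orthogonal_clauses)
qed

lemma cost_identity:
  "1/2 * ((norm (x - z))\<^sup>2 + (norm (y - z))\<^sup>2) =
     u_fun V1 V2 y - u_fun V1 V2 x - grad_u V1 V2 x \<bullet> (z - x) + grad_u V1 V2 y \<bullet> (z - y)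
     + cost_gap V1 V2 (x, y, z)"
proof -
  note lin = linear_diff[OF linear_orth_proj[OF subspaces(1)]]
    linear_diff[OF linear_orth_proj[OF subspaces(2)]]
  show ?thesis
    unfolding u_fun_def grad_u_def cost_gap_def prod.case power2_norm_eq_inner
    unfolding inner_decompose[of "x - z" "x - z"] inner_decompose[of "y - z" "y - z"]
      inner_decompose[of _ "z - x"] inner_decompose[of _ "z - y"]
    by (simp add: lin orth_proj_orth_proj algebra_simps inner_commute)
qed

lemma cost_gap_nonneg: "0 \<le> cost_gap V1 V2 w"
  by (simp add: cost_gap_def case_prod_beta)

lemma cost_gap_R_map: "cost_gap V1 V2 (R_map V1 V2 p) = 0"
proof -
  note lin = linear_orth_proj[OF subspaces(1)] linear_orth_proj[OF subspaces(2)]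
  show ?thesis
    by (simp add: cost_gap_def R_map_def case_prod_beta linear_diff[OF lin(1)]
        linear_diff[OF lin(2)] linear_add[OF lin(1)] linear_add[OF lin(2)] orth_proj_orth_proj)
qed

lemma norm_grad_u: "norm (grad_u V1 V2 x) = norm x"
proof -
  have "(norm (grad_u V1 V2 x))\<^sup>2 = (norm x)\<^sup>2"
    unfolding power2_norm_eq_inner inner_decompose[of x x]
      inner_decompose[of "grad_u V1 V2 x" "grad_u V1 V2 x"]
    by (simp add: grad_u_def linear_diff[OF linear_orth_proj[OF subspaces(1)]]
        linear_diff[OF linear_orth_proj[OF subspaces(2)]] orth_proj_orth_proj
        linear_0[OF linear_orth_proj[OF subspaces(1)]])
  then show ?thesis by simp
qed

lemma abs_u_fun_le: "\<bar>u_fun V1 V2 x\<bar> \<le> (norm x)\<^sup>2"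
proof -
  have "(norm (orth_proj V1 x))\<^sup>2 \<le> (norm x)\<^sup>2" "(norm (orth_proj V2 x))\<^sup>2 \<le> (norm x)\<^sup>2"
    using norm_orth_proj_le subspaces by (auto intro: power_mono)
  moreover have "0 \<le> (norm (orth_proj V1 x))\<^sup>2" "0 \<le> (norm (orth_proj V2 x))\<^sup>2" by auto
  ultimately show ?thesis unfolding u_fun_def by linarith
qed

end

section \<open>Square integrable functions and martingale conditions\<close>

lemma integrable_inner_of_square_integrable:
  fixes X Y :: "'b \<Rightarrow> 'a::euclidean_space"
  assumes [measurable]: "X \<in> borel_measurable M" "Y \<in> borel_measurable M"
    and "integrable M (\<lambda>w. (norm (X w))\<^sup>2)" "integrable M (\<lambda>w. (norm (Y w))\<^sup>2)"
  shows "integrable M (\<lambda>w. norm (X w) * norm (Y w))" "integrable M (\<lambda>w. X w \<bullet> Y w)"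
proof -
  have int: "integrable M (\<lambda>w. (norm (X w))\<^sup>2 + (norm (Y w))\<^sup>2)"
    using assms by simp
  have *: "norm (X w) * norm (Y w) \<le> (norm (X w))\<^sup>2 + (norm (Y w))\<^sup>2" for w
  proof -
    have "2 * (norm (X w) * norm (Y w)) \<le> (norm (X w))\<^sup>2 + (norm (Y w))\<^sup>2"
      using sum_squares_bound[of "norm (X w)" "norm (Y w)"] by simp
    moreover have "0 \<le> norm (X w) * norm (Y w)" by simp
    ultimately show ?thesis by linarith
  qed
  show "integrable M (\<lambda>w. norm (X w) * norm (Y w))"
    by (rule Bochner_Integration.integrable_bound[OF int]) (use * in \<open>auto simp: abs_mult\<close>)
  then show "integrable M (\<lambda>w. X w \<bullet> Y w)"
    by (rule Bochner_Integration.integrable_bound)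
       (auto simp: abs_mult intro: Cauchy_Schwarz_ineq2)
qed

lemma integrable_of_square_integrable:
  fixes X :: "'b \<Rightarrow> 'a::euclidean_space"
  assumes "finite_measure M" and [measurable]: "X \<in> borel_measurable M"
    and "integrable M (\<lambda>w. (norm (X w))\<^sup>2)"
  shows "integrable M X"
proof -
  interpret finite_measure M by fact
  have int: "integrable M (\<lambda>w. 1 + (norm (X w))\<^sup>2)" using assms by simp
  have "norm (X w) \<le> 1 + (norm (X w))\<^sup>2" for w
  proof -
    have "2 * norm (X w) \<le> 1 + (norm (X w))\<^sup>2"
      using sum_squares_bound[of 1 "norm (X w)"] by simp
    then show ?thesis using norm_ge_zero[of "X w"] by linarith
  qed
  then show ?thesis
    by (intro Bochner_Integration.integrable_bound[OF int]) auto
qed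

lemma square_integrable_add:
  fixes X Y :: "'b \<Rightarrow> 'a::euclidean_space"
  assumes [measurable]: "X \<in> borel_measurable M" "Y \<in> borel_measurable M"
    and "integrable M (\<lambda>w. (norm (X w))\<^sup>2)" "integrable M (\<lambda>w. (norm (Y w))\<^sup>2)"
  shows "integrable M (\<lambda>w. (norm (X w + Y w))\<^sup>2)"
proof -
  have "(norm (X w + Y w))\<^sup>2 = (norm (X w))\<^sup>2 + 2 * (X w \<bullet> Y w) + (norm (Y w))\<^sup>2" for w
    by (simp add: power2_norm_eq_inner algebra_simps inner_commute)
  then show ?thesis
    using assms integrable_inner_of_square_integrable(2)[of X M Y] by simp
qed

text \<open>
  If \<open>D\<close> is orthogonal to all bounded Borel functions of \<open>X\<close>, then it is orthogonal to every
  square integrable Borel function \<open>f\<close> of \<open>X\<close>. The coordinates of \<open>f\<close>, cut off where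
  \<open>\<parallel>f\<parallel> > k\<close>, are bounded test functions, and dominated convergence lets \<open>k\<close> tend to infinity.
\<close>
lemma integral_inner_eq_0_of_bounded_tests:
  fixes X D :: "'b \<Rightarrow> 'a::euclidean_space" and f :: "'a \<Rightarrow> 'a"
  assumes fin: "finite_measure M"
    and meas [measurable]: "X \<in> borel_measurable M" "D \<in> borel_measurable M"
      "f \<in> borel_measurable borel"
    and fX: "integrable M (\<lambda>w. (norm (f (X w)))\<^sup>2)" and D: "integrable M (\<lambda>w. (norm (D w))\<^sup>2)"
    and test: "\<And>g. g \<in> bounded_borel \<Longrightarrow> (LINT w|M. g (X w) *\<^sub>R D w) = 0"
  shows "(LINT w|M. f (X w) \<bullet> D w) = 0"
proof -
  define s where "s k v = (if norm (f v) \<le> real k then f v else 0)" for k v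
  have [measurable]: "s k \<in> borel_measurable borel" for k
    unfolding s_def by measurable
  have int_D: "integrable M D"
    by (rule integrable_of_square_integrable[OF fin meas(2) D])
  have "(\<lambda>k. LINT w|M. s k (X w) \<bullet> D w) \<longlonglongrightarrow> (LINT w|M. f (X w) \<bullet> D w)"
  proof (rule integral_dominated_convergence)
    show "integrable M (\<lambda>w. norm (f (X w)) * norm (D w))"
      using fX D by (intro integrable_inner_of_square_integrable(1)) auto
    show "AE w in M. (\<lambda>k. s k (X w) \<bullet> D w) \<longlonglongrightarrow> f (X w) \<bullet> D w"
    proof (intro AE_I2 tendsto_eventually)
      fix w
      obtain N :: nat where "norm (f (X w)) \<le> real N" using real_arch_simple by blast
      then show "\<forall>\<^sub>F k in sequentially. s k (X w) \<bullet> D w = f (X w) \<bullet> D w"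
        unfolding eventually_sequentially
        by (intro exI[of _ N]) (auto simp: s_def)
    qed
    show "AE w in M. norm (s k (X w) \<bullet> D w) \<le> norm (f (X w)) * norm (D w)" for k
      using Cauchy_Schwarz_ineq2 by (auto simp: s_def)
  qed measurable
  moreover have "(LINT w|M. s k (X w) \<bullet> D w) = 0" for k
  proof -
    have bb: "(\<lambda>v. s k v \<bullet> b) \<in> bounded_borel" if "b \<in> Basis" for b
    proof -
      have "\<bar>s k v \<bullet> b\<bar> \<le> real k" for v
        using Basis_le_norm[OF that, of "s k v"] by (auto simp: s_def)
      then show ?thesis
        unfolding bounded_borel_def by (auto intro!: boundedI)
    qed
    have int: "integrable M (\<lambda>w. (s k (X w) \<bullet> b) *\<^sub>R D w)" if "b \<in> Basis" for b
    proof (rule Bochner_Integration.integrable_bound[of M "\<lambda>w. real k *\<^sub>R D w"])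
      have "\<bar>s k v \<bullet> b\<bar> \<le> real k" for v
        using Basis_le_norm[OF that, of "s k v"] by (auto simp: s_def)
      then show "AE w in M. norm ((s k (X w) \<bullet> b) *\<^sub>R D w) \<le> norm (real k *\<^sub>R D w)"
        by (auto intro!: mult_right_mono)
    qed (use int_D in auto)
    have "(LINT w|M. s k (X w) \<bullet> D w) = (LINT w|M. (\<Sum>b\<in>Basis. ((s k (X w) \<bullet> b) *\<^sub>R D w) \<bullet> b))"
      by (subst euclidean_inner) simp
    also have "\<dots> = (\<Sum>b\<in>Basis. (LINT w|M. (s k (X w) \<bullet> b) *\<^sub>R D w) \<bullet> b)"
      using int by (subst Bochner_Integration.integral_sum) (auto simp: integral_inner_left simp del: inner_scaleR_left)
    also have "\<dots> = 0"
      using test[OF bb] by simp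
    finally show ?thesis .
  qed
  ultimately have "(\<lambda>k::nat. 0) \<longlonglongrightarrow> (LINT w|M. f (X w) \<bullet> D w)"
    by simp
  then show ?thesis
    using LIMSEQ_const_iff by metis
qed

section \<open>The cost of an admissible measure\<close>

lemma prob_moment_2D:
  assumes "\<mu> \<in> prob_moment 2"
  shows "prob_space \<mu>" "sets \<mu> = sets borel" "integrable \<mu> (\<lambda>x. (norm x)\<^sup>2)"
  using assms by (auto simp: prob_moment_def borel_prob_def powr_numeral)

context
  fixes V1 V2 :: "'a::euclidean_space set" and \<mu> \<nu> :: "'a measure"
  assumes subspaces: "subspace V1" "subspace V2"
    and orth: "\<forall>x\<in>V1. \<forall>y\<in>V2. orthogonal x y"
    and compl: "complementing V1 V2"
    and mu: "\<mu> \<in> prob_moment 2" and nu: "\<nu> \<in> prob_moment 2"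
begin

lemma measurable_projs [measurable]:
  "orth_proj V1 \<in> borel_measurable borel" "orth_proj V2 \<in> borel_measurable borel"
  using borel_measurable_orth_proj subspaces by auto

lemma measurable_u_grad_u [measurable]:
  "u_fun V1 V2 \<in> borel_measurable borel" "grad_u V1 V2 \<in> borel_measurable borel"
  unfolding u_fun_def[abs_def] grad_u_def[abs_def] by measurable

lemma J_cost_eq:
  assumes \<tau>: "\<tau> \<in> Sigma_set \<mu> \<nu>" and finite_cost: "J_cost \<tau> < \<infinity>"
  shows "J_cost \<tau> = ennreal (I_functional \<mu> \<nu> (u_fun V1 V2) + (LINT w|\<tau>. cost_gap V1 V2 w))"
proof -
  let ?X = "\<lambda>w::'a \<times> 'a \<times> 'a. fst w"
  let ?Y = "\<lambda>w::'a \<times> 'a \<times> 'a. fst (snd w)"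
  let ?Z = "\<lambda>w::'a \<times> 'a \<times> 'a. snd (snd w)"
  let ?c = "\<lambda>w. 1/2 * ((norm (?X w - ?Z w))\<^sup>2 + (norm (?Y w - ?Z w))\<^sup>2)"
  let ?u = "u_fun V1 V2" and ?q = "grad_u V1 V2"
  have "prob_space \<tau>" and sets [measurable_cong]: "sets \<tau> = sets borel"
    using \<tau> by (auto simp: Sigma_set_def borel_prob_def)
  then interpret prob_space \<tau> by simp
  have sets_prod: "sets \<tau> = sets (borel \<Otimes>\<^sub>M (borel \<Otimes>\<^sub>M borel))"
    unfolding sets borel_prod ..
  have meas [measurable]: "?X \<in> borel_measurable \<tau>" "?Y \<in> borel_measurable \<tau>"
      "?Z \<in> borel_measurable \<tau>"
    unfolding measurable_cong_sets[OF sets_prod refl] by measurable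
  have marg: "distr \<tau> borel ?X = \<mu>" "distr \<tau> borel ?Y = \<nu>"
    using \<tau> by (simp_all add: Sigma_set_def case_prod_beta')
  have test: "(LINT w|\<tau>. g (?X w) *\<^sub>R (?Z w - ?X w)) = 0"
      "(LINT w|\<tau>. g (?Y w) *\<^sub>R (?Z w - ?Y w)) = 0" if "g \<in> bounded_borel" for g
    using \<tau> that by (auto simp: Sigma_set_def case_prod_beta')

  have sq: "integrable \<tau> (\<lambda>w. (norm (?X w))\<^sup>2)" "integrable \<tau> (\<lambda>w. (norm (?Y w))\<^sup>2)"
    using prob_moment_2D(3)[OF mu] prob_moment_2D(3)[OF nu]
    by (simp_all add: marg[symmetric] integrable_distr_eq)
  have u_int: "integrable \<tau> (\<lambda>w. ?u (?X w))" "integrable \<tau> (\<lambda>w. ?u (?Y w))"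
    by (rule Bochner_Integration.integrable_bound[OF sq(1)],
        use abs_u_fun_le[OF subspaces orth compl] in auto)
       (rule Bochner_Integration.integrable_bound[OF sq(2)],
        use abs_u_fun_le[OF subspaces orth compl] in auto)
  have u_eq: "(LINT x|\<mu>. ?u x) = (LINT w|\<tau>. ?u (?X w))" "(LINT x|\<nu>. ?u x) = (LINT w|\<tau>. ?u (?Y w))"
    by (simp_all add: marg[symmetric] integral_distr)

  have c_int: "integrable \<tau> ?c"
    using finite_cost by (intro integrableI_nonneg) (auto simp: J_cost_def case_prod_beta')
  have dist_le: "(norm (?Z w - ?X w))\<^sup>2 \<le> 2 * ?c w" "(norm (?Z w - ?Y w))\<^sup>2 \<le> 2 * ?c w" for w
    unfolding norm_minus_commute[of "?Z w"] by simp_all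
  have dsq: "integrable \<tau> (\<lambda>w. (norm (?Z w - ?X w))\<^sup>2)"
    by (rule Bochner_Integration.integrable_bound[OF integrable_mult_right[OF c_int, of 2]])
       (use dist_le(1) in auto)
  have dsq': "integrable \<tau> (\<lambda>w. (norm (?Z w - ?Y w))\<^sup>2)"
    by (rule Bochner_Integration.integrable_bound[OF integrable_mult_right[OF c_int, of 2]])
       (use dist_le(2) in auto)
  have q_sq: "integrable \<tau> (\<lambda>w. (norm (?q (?X w)))\<^sup>2)" "integrable \<tau> (\<lambda>w. (norm (?q (?Y w)))\<^sup>2)"
    using sq by (simp_all add: norm_grad_u[OF subspaces orth compl])
  have meas_q: "(\<lambda>w. ?q (?X w)) \<in> borel_measurable \<tau>" "(\<lambda>w. ?q (?Y w)) \<in> borel_measurable \<tau>"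
      "(\<lambda>w. ?Z w - ?X w) \<in> borel_measurable \<tau>" "(\<lambda>w. ?Z w - ?Y w) \<in> borel_measurable \<tau>"
    by measurable
  have q_int: "integrable \<tau> (\<lambda>w. ?q (?X w) \<bullet> (?Z w - ?X w))"
      "integrable \<tau> (\<lambda>w. ?q (?Y w) \<bullet> (?Z w - ?Y w))"
    using integrable_inner_of_square_integrable(2)[OF meas_q(1,3) q_sq(1) dsq]
      integrable_inner_of_square_integrable(2)[OF meas_q(2,4) q_sq(2) dsq'] by this
  have q_0: "(LINT w|\<tau>. ?q (?X w) \<bullet> (?Z w - ?X w)) = 0"
      "(LINT w|\<tau>. ?q (?Y w) \<bullet> (?Z w - ?Y w)) = 0"
    using integral_inner_eq_0_of_bounded_tests[OF finite_measure_axioms meas(1) meas_q(3)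
        measurable_u_grad_u(2) q_sq(1) dsq test(1)]
      integral_inner_eq_0_of_bounded_tests[OF finite_measure_axioms meas(2) meas_q(4)
        measurable_u_grad_u(2) q_sq(2) dsq' test(2)] by blast+

  have c_eq: "?c w = ?u (?Y w) - ?u (?X w) - ?q (?X w) \<bullet> (?Z w - ?X w)
      + ?q (?Y w) \<bullet> (?Z w - ?Y w) + cost_gap V1 V2 w" for w
    using cost_identity[OF subspaces orth compl, of "?X w" "?Z w" "?Y w"] by simp
  have gap_eq: "cost_gap V1 V2 w = ?c w - (?u (?Y w) - ?u (?X w)) + ?q (?X w) \<bullet> (?Z w - ?X w)
      - ?q (?Y w) \<bullet> (?Z w - ?Y w)" for w
    using c_eq[of w] by linarith
  have "(LINT w|\<tau>. cost_gap V1 V2 w) = (LINT w|\<tau>. ?c w) - I_functional \<mu> \<nu> ?u"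
    unfolding gap_eq I_functional_def u_eq using c_int u_int q_int q_0
    by (simp del: times_divide_eq_left)
  moreover have "J_cost \<tau> = ennreal (LINT w|\<tau>. ?c w)"
    unfolding J_cost_def case_prod_beta' using c_int by (intro nn_integral_eq_integral) auto
  ultimately show ?thesis by simp
qed

corollary J_cost_ge:
  assumes "\<tau> \<in> Sigma_set \<mu> \<nu>"
  shows "ennreal (I_functional \<mu> \<nu> (u_fun V1 V2)) \<le> J_cost \<tau>"
proof (cases "J_cost \<tau> < \<infinity>")
  case True
  have "0 \<le> (LINT w|\<tau>. cost_gap V1 V2 w)"
    by (simp add: cost_gap_nonneg[OF subspaces orth compl])
  then show ?thesis
    unfolding J_cost_eq[OF assms True] by (intro ennreal_leI) simp
next
  case False
  then show ?thesis by (simp add: less_top[symmetric])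
qed

section \<open>The pushforward of a coupling\<close>

context
  fixes \<pi> :: "('a \<times> 'a) measure"
  assumes pi: "\<pi> \<in> Gamma_bm \<mu> \<nu> V1 V2"
begin

lemma prob_space_pi: "prob_space \<pi>"
  using pi by (auto simp: Gamma_bm_def couplings_def borel_prob_def)

lemma sets_pi: "sets \<pi> = sets borel"
  using pi by (auto simp: Gamma_bm_def couplings_def borel_prob_def)

lemma measurable_coords [measurable]:
  "fst \<in> borel_measurable \<pi>" "snd \<in> borel_measurable \<pi>"
proof -
  have "sets \<pi> = sets (borel \<Otimes>\<^sub>M borel)" unfolding sets_pi borel_prod ..
  then show "fst \<in> borel_measurable \<pi>" "snd \<in> borel_measurable \<pi>"
    by (auto simp: measurable_cong_sets[of \<pi> _ borel borel])
qed

lemma measurable_R_map [measurable]: "R_map V1 V2 \<in> measurable \<pi> borel"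
  unfolding R_map_def case_prod_beta borel_prod[symmetric] by measurable

lemma marginals_pi: "distr \<pi> borel fst = \<mu>" "distr \<pi> borel snd = \<nu>"
  using pi by (auto simp: Gamma_bm_def couplings_def)

lemma square_integrable_pi:
  "integrable \<pi> (\<lambda>w. (norm (fst w))\<^sup>2)" "integrable \<pi> (\<lambda>w. (norm (snd w))\<^sup>2)"
  using prob_moment_2D(3)[OF mu] prob_moment_2D(3)[OF nu]
  by (simp_all add: marginals_pi[symmetric] integrable_distr_eq)

lemma integrable_pi:
  "integrable \<pi> (\<lambda>w. fst w)" "integrable \<pi> (\<lambda>w. snd w)"
  using integrable_of_square_integrable[OF prob_space.finite_measure[OF prob_space_pi]]
    measurable_coords square_integrable_pi by blast+

lemma integrable_scaled_proj:
  assumes "g \<in> bounded_borel" and [measurable]: "X \<in> borel_measurable \<pi>" "Y \<in> borel_measurable \<pi>"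
    and W: "W = V1 \<or> W = V2" and Y: "integrable \<pi> Y"
  shows "integrable \<pi> (\<lambda>w. g (X w) *\<^sub>R orth_proj W (Y w))"
proof -
  have [measurable]: "g \<in> borel_measurable borel" and "bounded (range g)"
    using assms by (auto simp: bounded_borel_def)
  then obtain B where B: "\<And>v. \<bar>g v\<bar> \<le> B"
    by (auto simp: bounded_iff)
  have [measurable]: "orth_proj W \<in> borel_measurable borel"
    using W measurable_projs by auto
  have "norm (orth_proj W v) \<le> norm v" for v
    using W norm_orth_proj_le subspaces by auto
  then have "\<bar>g (X w)\<bar> * norm (orth_proj W (Y w)) \<le> \<bar>B\<bar> * norm (Y w)" for w
    using B[of "X w"] by (intro mult_mono) auto
  then show ?thesis
    by (intro Bochner_Integration.integrable_bound[OF integrable_scaleR_right[OF Y, of B]]) auto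
qed

lemma distr_R_map_in_Sigma_set: "distr \<pi> borel (R_map V1 V2) \<in> Sigma_set \<mu> \<nu>"
proof -
  let ?\<sigma> = "distr \<pi> borel (R_map V1 V2)"
  let ?z = "\<lambda>w. orth_proj V2 (fst w) + orth_proj V1 (snd w)"
  interpret prob_space \<pi> by (rule prob_space_pi)
  have meas3: "(\<lambda>w::'a\<times>'a\<times>'a. fst w) \<in> borel_measurable borel"
      "(\<lambda>w::'a\<times>'a\<times>'a. fst (snd w)) \<in> borel_measurable borel"
      "(\<lambda>w::'a\<times>'a\<times>'a. snd (snd w)) \<in> borel_measurable borel"
    by (intro borel_measurable_continuous_onI continuous_intros)+
  note [measurable] = meas3
  have comp: "fst (R_map V1 V2 w) = fst w" "fst (snd (R_map V1 V2 w)) = snd w"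
      "snd (snd (R_map V1 V2 w)) = ?z w" for w
    by (simp_all add: R_map_def case_prod_beta)
  have split: "orth_proj V1 x + orth_proj V2 x = x" for x
    by (rule orth_proj_complementing[OF subspaces orth compl])
  have "borel_prob ?\<sigma>"
    by (simp add: borel_prob_def prob_space_distr)
  moreover have "distr ?\<sigma> borel (\<lambda>(x, y, z). x) = \<mu>" "distr ?\<sigma> borel (\<lambda>(x, y, z). y) = \<nu>"
    by (simp_all add: case_prod_beta distr_distr comp_def comp marginals_pi)
  moreover have "distr ?\<sigma> borel (\<lambda>(x, y, z). z) \<in> prob_moment 1"
  proof -
    have "distr ?\<sigma> borel (\<lambda>(x, y, z). z) = distr \<pi> borel ?z"
      by (simp add: case_prod_beta distr_distr comp_def comp)
    moreover have "integrable \<pi> ?z"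
      using integrable_scaled_proj[of "\<lambda>_. 1" fst fst V2]
        integrable_scaled_proj[of "\<lambda>_. 1" fst snd V1] integrable_pi
      by (simp add: bounded_borel_def image_constant_conv)
    ultimately show ?thesis
      by (simp add: prob_moment_def borel_prob_def prob_space_distr integrable_distr_eq)
  qed
  moreover have "(LINT (x, y, z)|?\<sigma>. g x *\<^sub>R (z - x)) = 0" if g: "g \<in> bounded_borel" for g
  proof -
    have [measurable]: "g \<in> borel_measurable borel" using g by (auto simp: bounded_borel_def)
    have eq: "?z w - fst w = orth_proj V1 (snd w) - orth_proj V1 (fst w)" for w
      using split[of "fst w"] by (simp add: algebra_simps)
    have "(LINT (x, y, z)|?\<sigma>. g x *\<^sub>R (z - x)) =
        (LINT w|\<pi>. g (fst w) *\<^sub>R (?z w - fst w))"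
      by (simp add: case_prod_beta integral_distr comp)
    also have "\<dots> =
        (LINT w|\<pi>. g (fst w) *\<^sub>R orth_proj V1 (snd w) - g (fst w) *\<^sub>R orth_proj V1 (fst w))"
      unfolding eq scaleR_diff_right ..
    also have "\<dots> = 0"
      using integrable_scaled_proj[OF g, of fst snd V1] integrable_scaled_proj[OF g, of fst fst V1]
        integrable_pi pi g
      by (simp add: Gamma_bm_def case_prod_beta')
    finally show ?thesis .
  qed
  moreover have "(LINT (x, y, z)|?\<sigma>. h y *\<^sub>R (z - y)) = 0" if h: "h \<in> bounded_borel" for h
  proof -
    have [measurable]: "h \<in> borel_measurable borel" using h by (auto simp: bounded_borel_def)
    have eq: "?z w - snd w = orth_proj V2 (fst w) - orth_proj V2 (snd w)" for w
      using split[of "snd w"] by (simp add: algebra_simps)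
    have "(LINT (x, y, z)|?\<sigma>. h y *\<^sub>R (z - y)) =
        (LINT w|\<pi>. h (snd w) *\<^sub>R (?z w - snd w))"
      by (simp add: case_prod_beta integral_distr comp)
    also have "\<dots> =
        (LINT w|\<pi>. h (snd w) *\<^sub>R orth_proj V2 (fst w) - h (snd w) *\<^sub>R orth_proj V2 (snd w))"
      unfolding eq scaleR_diff_right ..
    also have "\<dots> = 0"
      using integrable_scaled_proj[OF h, of snd fst V2] integrable_scaled_proj[OF h, of snd snd V2]
        integrable_pi pi h
      by (simp add: Gamma_bm_def case_prod_beta')
    finally show ?thesis .
  qed
  ultimately show ?thesis by (auto simp: Sigma_set_def)
qed

text \<open>Under \<open>R_map\<close> the cost becomes \<open>1/2 \<parallel>x - y\<parallel>\<^sup>2\<close>, which is integrable.\<close>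
lemma J_cost_distr_R_map_finite: "J_cost (distr \<pi> borel (R_map V1 V2)) < \<infinity>"
proof -
  let ?c = "\<lambda>w::'a\<times>'a\<times>'a. 1/2 * ((norm (fst w - snd (snd w)))\<^sup>2 + (norm (fst (snd w) - snd (snd w)))\<^sup>2)"
  have c_meas: "?c \<in> borel_measurable borel"
    by (intro borel_measurable_continuous_onI continuous_intros)
  have eq: "?c (R_map V1 V2 w) = 1/2 * (norm (fst w + - snd w))\<^sup>2" for w
  proof -
    note lin = linear_diff[OF linear_orth_proj[OF subspaces(1)]]
      linear_diff[OF linear_orth_proj[OF subspaces(2)]]
    note split = orth_proj_complementing[OF subspaces orth compl]
    have "fst w - (orth_proj V2 (fst w) + orth_proj V1 (snd w)) = orth_proj V1 (fst w - snd w)"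
      "snd w - (orth_proj V2 (fst w) + orth_proj V1 (snd w)) = - orth_proj V2 (fst w - snd w)"
      using split[of "fst w"] split[of "snd w"] by (simp_all add: lin algebra_simps)
    then show ?thesis
      using inner_decompose[OF subspaces orth compl, of "fst w - snd w" "fst w - snd w"]
      by (simp add: R_map_def case_prod_beta power2_norm_eq_inner)
  qed
  have "J_cost (distr \<pi> borel (R_map V1 V2)) = (\<integral>\<^sup>+ w. ennreal (?c (R_map V1 V2 w)) \<partial>\<pi>)"
    unfolding J_cost_def case_prod_beta
    using measurable_compose[OF c_meas measurable_ennreal]
    by (intro nn_integral_distr) (simp_all add: measurable_R_map)
  also have "\<dots> = (\<integral>\<^sup>+ w. ennreal (1/2 * (norm (fst w + - snd w))\<^sup>2) \<partial>\<pi>)"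
    unfolding eq ..
  also have "\<dots> < \<infinity>"
  proof -
    have "integrable \<pi> (\<lambda>w. (norm (fst w + - snd w))\<^sup>2)"
      using square_integrable_pi by (intro square_integrable_add) auto
    then have "integrable \<pi> (\<lambda>w. 1/2 * (norm (fst w + - snd w))\<^sup>2)"
      by (rule integrable_mult_right)
    then show ?thesis
      by (subst nn_integral_eq_integral) auto
  qed
  finally show ?thesis .
qed

lemma J_cost_distr_R_map:
  "J_cost (distr \<pi> borel (R_map V1 V2)) = ennreal (I_functional \<mu> \<nu> (u_fun V1 V2))"
proof -
  have "(LINT w|distr \<pi> borel (R_map V1 V2). cost_gap V1 V2 w) = 0"
  proof -
    have [measurable]: "cost_gap V1 V2 \<in> borel_measurable borel"
      unfolding cost_gap_def case_prod_beta borel_prod[symmetric] by measurable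
    show ?thesis
      by (simp add: integral_distr cost_gap_R_map[OF subspaces orth compl])
  qed
  then show ?thesis
    using J_cost_eq[OF distr_R_map_in_Sigma_set J_cost_distr_R_map_finite] by simp
qed

end

end

section \<open>Optimality\<close>

theorem proposition3p15:
  fixes \<mu> \<nu> :: "(real ^ 'n) measure"
    and u :: "real ^ 'n \<Rightarrow> real"
    and V1 V2 :: "(real ^ 'n) set"
    and \<pi> :: "((real ^ 'n) \<times> (real ^ 'n)) measure"
    and \<sigma> :: "((real ^ 'n) \<times> (real ^ 'n) \<times> (real ^ 'n)) measure"
  assumes "\<mu> \<in> prob_moment 2" and "\<nu> \<in> prob_moment 2"
    and "barycentre \<mu> = barycentre \<nu>"
    and "u \<in> C11" and "isometric_derivative u" and "I_attained_by \<mu> \<nu> u"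
    and "subspace V1" and "subspace V2"
    and "\<forall>x\<in>V1. \<forall>y\<in>V2. orthogonal x y" and "complementing V1 V2"
    and "\<exists>l b. linear l \<and> (\<forall>x. u x + (l x + b) = u_fun V1 V2 x)"
    and "\<pi> \<in> Gamma_bm \<mu> \<nu> V1 V2"
    and "\<sigma> = distr \<pi> borel (R_map V1 V2)"
  shows "\<sigma> \<in> Sigma_set \<mu> \<nu> \<and> J_optimal \<mu> \<nu> \<sigma>"
proof -
  note VV = assms(7-10)
  have mem: "\<sigma> \<in> Sigma_set \<mu> \<nu>"
    using distr_R_map_in_Sigma_set[OF VV assms(1,2,12)] assms(13) by simp
  moreover have "J_cost \<sigma> = J_value \<mu> \<nu>"
    unfolding J_value_def
  proof (rule antisym)
    show "J_cost \<sigma> \<le> (INF \<tau>\<in>Sigma_set \<mu> \<nu>. J_cost \<tau>)"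
      using J_cost_ge[OF VV assms(1,2)] J_cost_distr_R_map[OF VV assms(1,2,12)] assms(13)
      by (auto intro!: INF_greatest)
    show "(INF \<tau>\<in>Sigma_set \<mu> \<nu>. J_cost \<tau>) \<le> J_cost \<sigma>"
      using mem by (rule INF_lower)
  qed
  ultimately show ?thesis by (simp add: J_optimal_def)
qed

end
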